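(* Let $p$ be an odd prime and let $\lambda\in\mathbb{C}_p$ with $\lambda\neq 0$ and $|\lambda|_p\le 1$. For every $n\ge 0$, \[ \sum_{l=0}^n S_1(n,l)\int_{\mathbb{Z}_p}(x+y)_{l,\lambda}\,d\mu_{-1}(y)=Ch_{n,\lambda}(x). \]
   Context: $\mathbb{C}_p$ is the completion of an algebraic closure of $\mathbb{Q}_p$, and $|\cdot|_p$ is normalized by $|p|_p=1/p$. For a continuous $f:\mathbb{Z}_p\to\mathbb{C}_p$, the fermionic $p$-adic integral is $\int_{\mathbb{Z}_p}f(y)\,d\mu_{-1}(y)=\lim_{N\to\infty}\sum_{y=0}^{p^N-1}f(y)(-1)^y$. The $\lambda$-falling factorial is $(x)_{0,\lambda}=1$ and $(x)_{n,\lambda}=x(x-\lambda)\cdots(x-(n-1)\lambda)$ for $n\ge1$. The Stirling numbers of the first kind $S_1(n,l)$ are defined by $(x)_n=x(x-1)\cdots(x-n+1)=\sum_{l=0}^n S_1(n,l)x^l$. The degenerate Changhee polynomials of the second kind $Ch_{n,\lambda}(x)$ are defined by the generating function \[ \frac{2}{1+\big(1+\lambda\log(1+t)\big)^{1/\lambda}}\big(1+\lambda\log(1+t)\big)^{x/\lambda}=\sum_{n=0}^\infty Ch_{n,\lambda}(x)\frac{t^n}{n!}, \] where $(1+\lambda u)^{x/\lambda}$ denotes $\sum_{m\ge0}(x)_{m,\lambda}\,u^m/m!$. *)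

theory Defs
  imports "HOL-Analysis.Analysis" "HOL-Computational_Algebra.Computational_Algebra"
begin

text \<open>
  The field \<open>\<complex>\<^sub>p\<close> is not available as a type. It is specified here by its defining property: a field
  \<open>K\<close>, complete for a non-Archimedean absolute value with \<open>\<bar>p\<bar> = 1/p\<close>, in which the elements
  algebraic over \<open>\<rat>\<^sub>p\<close> form an algebraically closed dense subset. Since \<open>K\<close> is complete, \<open>\<rat>\<^sub>p\<close>, the
  completion of \<open>\<rat>\<close>, is the topological closure of \<open>\<rat>\<close> in \<open>K\<close>. These conditions determine \<open>K\<close> up to
  isometric isomorphism.
\<close>

definition Qp :: "'a::{field_char_0,metric_space} set" where
  "Qp = closure \<rat>"

definition Zp :: "'a::{field_char_0,metric_space} set" where
  "Zp = {x \<in> Qp. dist x 0 \<le> 1}"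

definition algebraic_over_Qp :: "'a::{field_char_0,metric_space} set" where
  "algebraic_over_Qp = {x. \<exists>q. q \<noteq> 0 \<and> (\<forall>i. coeff q i \<in> Qp) \<and> poly q x = 0}"

locale padic_complex_numbers =
  fixes p :: nat and absv :: "'a::{field_char_0,complete_space} \<Rightarrow> real"
  assumes dist_absv: "dist x y = absv (x - y)"
    and absv_mult: "absv (x * y) = absv x * absv y"
    and absv_add_le_max: "absv (x + y) \<le> max (absv x) (absv y)"
    and absv_p: "absv (of_nat p) = 1 / real p"
    and algebraic_over_Qp_closed:
      "\<lbrakk>degree (q :: 'a poly) > 0; \<forall>i. coeff q i \<in> algebraic_over_Qp\<rbrakk>
        \<Longrightarrow> \<exists>x\<in>algebraic_over_Qp. poly q x = 0"
    and algebraic_over_Qp_dense: "closure algebraic_over_Qp = (UNIV :: 'a set)"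

definition has_fermionic_integral ::
    "nat \<Rightarrow> ('a::{field_char_0,metric_space} \<Rightarrow> 'a) \<Rightarrow> 'a \<Rightarrow> bool" where
  "has_fermionic_integral p f I \<longleftrightarrow>
     continuous_on Zp f \<and> (\<lambda>N. \<Sum>y<p ^ N. f (of_nat y) * (-1) ^ y) \<longlonglongrightarrow> I"

definition fermionic_integral ::
    "nat \<Rightarrow> ('a::{field_char_0,metric_space} \<Rightarrow> 'a) \<Rightarrow> 'a" where
  "fermionic_integral p f = (THE I. has_fermionic_integral p f I)"

definition degenerate_ffact :: "'a::comm_ring_1 \<Rightarrow> 'a \<Rightarrow> nat \<Rightarrow> 'a" where
  "degenerate_ffact lam x n = (\<Prod>k<n. x - of_nat k * lam)"

text \<open>
  Signed Stirling numbers of the first kind, as the coefficients of the polynomial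
  \<open>X (X - 1) \<cdots> (X - n + 1)\<close> (the library function \<open>stirling\<close> is the unsigned version).
\<close>

definition stirling1 :: "nat \<Rightarrow> nat \<Rightarrow> int" where
  "stirling1 n l = coeff (degenerate_ffact 1 [:0, 1:] n) l"

text \<open>The series of \<open>(1 + lam u) powr (x / lam)\<close> in the indeterminate \<open>u\<close>.\<close>

definition degenerate_exp :: "'a::field_char_0 \<Rightarrow> 'a \<Rightarrow> 'a fps" where
  "degenerate_exp lam x = Abs_fps (\<lambda>m. degenerate_ffact lam x m / fact m)"

text \<open>Below, \<open>fps_ln 1\<close> is the series of \<open>log (1 + t)\<close>.\<close>

definition changhee2_genfun :: "'a::field_char_0 \<Rightarrow> 'a \<Rightarrow> 'a fps" where
  "changhee2_genfun lam x =
     2 / (1 + (degenerate_exp lam 1 oo fps_ln 1)) * (degenerate_exp lam x oo fps_ln 1)"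

definition changhee2 :: "nat \<Rightarrow> 'a::field_char_0 \<Rightarrow> 'a \<Rightarrow> 'a" where
  "changhee2 n lam x = fact n * fps_nth (changhee2_genfun lam x) n"

end

theory Submission imports Defs begin

text \<open>
  Write \<open>E x\<close> for \<open>degenerate_exp lam x\<close>. Since \<open>E (x + y) = E x * E y\<close>, the alternating sum of
  \<open>E (x + y)\<close> over \<open>y < M\<close> is, for odd \<open>M\<close>, the geometric sum \<open>E x * (1 + E M) / (1 + E 1)\<close>.
  For \<open>M = p ^ N\<close> the coefficients of \<open>E M\<close> tend \<open>p\<close>-adically to those of \<open>1\<close>, so the fermionic
  integrals of the degenerate falling factorials have the exponential generating function
  \<open>2 * E x / (1 + E 1)\<close>. Substituting \<open>log (1 + t)\<close>, whose divided powers generate the Stirling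
  numbers of the first kind, gives the claim.
\<close>

section \<open>Stirling numbers and powers of the logarithm\<close>

lemma degenerate_ffact_0 [simp]: "degenerate_ffact lam x 0 = 1"
  by (simp add: degenerate_ffact_def)

lemma degenerate_ffact_Suc:
  "degenerate_ffact lam x (Suc n) = degenerate_ffact lam x n * (x - of_nat n * lam)"
  by (simp add: degenerate_ffact_def)

lemma stirling1_0: "stirling1 0 l = (if l = 0 then 1 else 0)"
  by (simp add: stirling1_def)

text \<open>The last factor \<open>X - n\<close> splits the product into a degree shift and a scalar
  multiple; coefficients are then compared.\<close>

lemma stirling1_Suc:
  "stirling1 (Suc n) l = (if l = 0 then 0 else stirling1 n (l - 1)) - int n * stirling1 n l"
proof -
  have "degenerate_ffact 1 [:0, 1:] (Suc n) =
      pCons 0 (degenerate_ffact 1 [:0, 1:] n) - smult (int n) (degenerate_ffact 1 [:0, 1:] n)"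
    by (simp add: degenerate_ffact_Suc algebra_simps of_nat_poly)
  then show ?thesis
    by (simp add: stirling1_def coeff_pCons split: nat.split)
qed

text \<open>Differentiating \<open>L ^ l\<close> for \<open>L = log (1 + t)\<close> and clearing the
  denominator gives \<open>(1 + t) * (L ^ l)' = l * L ^ (l - 1)\<close>. Comparing coefficients
  yields, after scaling by factorials, exactly the recurrence of \<open>stirling1\<close>.\<close>

lemma fps_ln_power_nth:
  "fact n * fps_nth (fps_ln (1::'a::field_char_0) ^ l) n = fact l * of_int (stirling1 n l)"
proof (induction n arbitrary: l)
  case 0
  then show ?case
    by (simp add: stirling1_0 fps_power_zeroth power_0_left)
next
  case (Suc n)
  let ?L = "fps_ln (1::'a)"
  show ?case
  proof (cases l)
    case 0
    \<comment> \<open>For \<open>l = 0\<close> the recurrence leaves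
      \<open>- n * stirling1 n 0\<close>, which vanishes through the factor \<open>n\<close> if
      \<open>n = 0\<close> and by the induction hypothesis otherwise.\<close>
    then show ?thesis
      using Suc[of 0] by (cases n) (auto simp: stirling1_Suc stirling1_0)
  next
    case (Suc k)
    have "(1 + fps_X) * fps_deriv ?L = 1"
      by (simp add: fps_ln_deriv inverse_mult_eq_1')
    then have "of_nat l * ?L ^ k * ((1 + fps_X) * fps_deriv ?L) = of_nat l * ?L ^ k"
      by simp
    then have "(1 + fps_X) * fps_deriv (?L ^ l) = of_nat l * ?L ^ k"
      by (simp only: Suc fps_deriv_power' diff_Suc_1 mult_ac)
    then have "fps_nth ((1 + fps_X) * fps_deriv (?L ^ l)) n = of_nat l * fps_nth (?L ^ k) n"
      by (simp add: fps_of_nat[symmetric])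
    moreover have "fps_nth ((1 + fps_X) * fps_deriv (?L ^ l)) n =
        of_nat (Suc n) * fps_nth (?L ^ l) (Suc n) + of_nat n * fps_nth (?L ^ l) n"
      by (cases n) (simp_all add: distrib_right)
    ultimately have "of_nat (Suc n) * fps_nth (?L ^ l) (Suc n) =
        of_nat l * fps_nth (?L ^ k) n - of_nat n * fps_nth (?L ^ l) n"
      by (simp only: eq_diff_eq)
    moreover have "fact (Suc n) * fps_nth (?L ^ l) (Suc n) =
        fact n * (of_nat (Suc n) * fps_nth (?L ^ l) (Suc n))"
      by (simp only: fact_Suc mult_ac)
    ultimately have "fact (Suc n) * fps_nth (?L ^ l) (Suc n) =
        of_nat l * (fact n * fps_nth (?L ^ k) n) - of_nat n * (fact n * fps_nth (?L ^ l) n)"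
      by (simp only: right_diff_distrib mult_ac)
    also have "\<dots> = fact l * of_int (stirling1 (Suc n) l)"
      unfolding Suc.IH by (simp add: Suc stirling1_Suc algebra_simps)
    finally show ?thesis .
  qed
qed

text \<open>On exponential generating functions, substituting \<open>log (1 + t)\<close> acts as the
  Stirling transform. This is the shape of the left side of the theorem.\<close>

lemma fps_compose_ln_nth:
  "fact n * fps_nth (F oo fps_ln (1::'a::field_char_0)) n =
     (\<Sum>l\<le>n. of_int (stirling1 n l) * (fact l * fps_nth F l))"
proof -
  have "fact n * fps_nth (F oo fps_ln (1::'a)) n =
      (\<Sum>l\<le>n. fps_nth F l * (fact n * fps_nth (fps_ln 1 ^ l) n))"
    by (simp add: fps_compose_nth sum_distrib_left atLeast0AtMost mult_ac)
  then show ?thesis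
    by (simp add: fps_ln_power_nth mult_ac)
qed

section \<open>Degenerate exponentials\<close>

lemma degenerate_exp_nth: "fps_nth (degenerate_exp lam x) m = degenerate_ffact lam x m / fact m"
  by (simp add: degenerate_exp_def)

text \<open>Pulling \<open>lam\<close> out of each factor leaves an ordinary falling factorial of
  \<open>x / lam\<close>. The addition law of the binomial series thereby carries over to
  \<open>degenerate_exp\<close>.\<close>

lemma degenerate_exp_conv_binomial:
  assumes "lam \<noteq> 0"
  shows "degenerate_exp lam x = fps_binomial (x / lam) oo (fps_const lam * fps_X)"
proof (rule fps_ext)
  fix m
  have "degenerate_ffact lam x m = (\<Prod>k<m. lam * (x / lam - of_nat k))"
    unfolding degenerate_ffact_def
    using assms by (intro prod.cong) (auto simp: field_simps)
  also have "\<dots> = lam ^ m * (\<Prod>k<m. x / lam - of_nat k)"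
    by (simp add: prod.distrib)
  finally show "fps_nth (degenerate_exp lam x) m =
      fps_nth (fps_binomial (x / lam) oo (fps_const lam * fps_X)) m"
    by (simp add: degenerate_exp_nth fps_compose_linear gbinomial_prod_rev atLeast0LessThan)
qed

lemma degenerate_exp_add:
  assumes "lam \<noteq> 0"
  shows "degenerate_exp lam (x + y) = degenerate_exp lam x * degenerate_exp lam y"
  by (simp add: degenerate_exp_conv_binomial[OF assms] add_divide_distrib
      fps_binomial_add_mult fps_compose_mult_distrib)

lemma degenerate_exp_0: "degenerate_exp lam 0 = 1"
  by (rule fps_ext) (auto simp: degenerate_exp_nth degenerate_ffact_def)

lemma degenerate_exp_of_nat:
  assumes "lam \<noteq> 0"
  shows "degenerate_exp lam (of_nat k) = degenerate_exp lam 1 ^ k"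
  by (induction k) (simp_all add: degenerate_exp_0 degenerate_exp_add[OF assms])

lemma one_plus_degenerate_exp_nth_0: "fps_nth (1 + degenerate_exp lam 1) 0 = 2"
  by (simp add: degenerate_exp_nth)

lemma sum_alternating_degenerate_exp:
  assumes "lam \<noteq> 0" and "odd M"
  shows "(\<Sum>y<M. degenerate_exp lam (x + of_nat y) * (-1) ^ y) =
    degenerate_exp lam x * inverse (1 + degenerate_exp lam 1) * (1 + degenerate_exp lam (of_nat M))"
    (is "?S = ?E x * inverse (1 + ?E 1) * _")
proof -
  let ?T = "\<Sum>y<M. (- ?E 1) ^ y"
  \<comment> \<open>The ratio is \<open>- E 1\<close>; oddness of \<open>M\<close> turns
    \<open>1 - (- E 1) ^ M\<close> into \<open>1 + E 1 ^ M\<close>.\<close>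
  have geometric: "(1 + ?E 1) * ?T = 1 + ?E 1 ^ M"
    using one_diff_power_eq[of "- ?E 1" M] assms(2) by simp
  \<comment> \<open>The constant term is 2, nonzero in characteristic 0.\<close>
  have unit: "inverse (1 + ?E 1) * (1 + ?E 1) = 1"
    by (rule inverse_mult_eq_1) (simp only: one_plus_degenerate_exp_nth_0, simp)
  have "?S = ?E x * ?T"
    by (simp add: degenerate_exp_add[OF assms(1)] degenerate_exp_of_nat[OF assms(1)]
        sum_distrib_left power_minus[of "?E 1"] mult_ac)
  also have "\<dots> = ?E x * (inverse (1 + ?E 1) * (1 + ?E 1) * ?T)"
    by (simp only: unit mult_1_left)
  also have "\<dots> = ?E x * inverse (1 + ?E 1) * (1 + ?E (of_nat M))"
    by (simp only: mult.assoc geometric degenerate_exp_of_nat[OF assms(1)])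
  finally show ?thesis .
qed

lemma sum_alternating_degenerate_ffact:
  assumes "lam \<noteq> 0" and "odd M"
  shows "(\<Sum>y<M. degenerate_ffact lam (x + of_nat y) l * (-1) ^ y) =
    fact l * fps_nth (degenerate_exp lam x * inverse (1 + degenerate_exp lam 1) *
      (1 + degenerate_exp lam (of_nat M))) l"
proof -
  \<comment> \<open>On the left the sign is a constant power series, on the right a scalar.\<close>
  have nth: "fps_nth (F * (-1) ^ y) l = fps_nth F l * (-1) ^ y" for F :: "'a fps" and y
    by (cases "even y") auto
  show ?thesis
    unfolding sum_alternating_degenerate_exp[OF assms, symmetric]
    by (simp add: fps_sum_nth nth degenerate_exp_nth sum_distrib_left)
qed

text \<open>Since \<open>log (1 + t)\<close> has zero constant term, substituting it respects sums,
  products and inverses of units, so it can be moved outside the whole expression.\<close>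

lemma changhee2_genfun_eq_compose:
  "changhee2_genfun lam x =
     (2 * (degenerate_exp lam x * inverse (1 + degenerate_exp lam 1))) oo fps_ln 1"
proof -
  let ?E = "degenerate_exp lam" and ?L = "fps_ln (1::'a)"
  have L0: "fps_nth ?L 0 = 0" by simp
  have two: "2 oo ?L = 2"
    by (metis fps_const_compose fps_numeral_fps_const)
  have ne: "fps_nth (1 + ?E 1) 0 \<noteq> 0"
    by (simp only: one_plus_degenerate_exp_nth_0) simp
  have "1 + (?E 1 oo ?L) = (1 + ?E 1) oo ?L"
    by (simp add: fps_compose_add_distrib)
  moreover have "inverse (1 + ?E 1) oo ?L = inverse ((1 + ?E 1) oo ?L)"
    using fps_inverse_compose[OF L0 ne] .
  moreover have "fps_nth ((1 + ?E 1) oo ?L) 0 \<noteq> 0"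
    using ne by (simp only: fps_compose_nth_0 not_False_eq_True)
  ultimately show ?thesis
    by (simp add: changhee2_genfun_def fps_divide_unit fps_compose_mult_distrib[OF L0] two mult_ac)
qed

section \<open>Limits and the fermionic integral\<close>

context padic_complex_numbers
begin

section \<open>Elementary properties of the absolute value\<close>

lemma absv_eq_dist: "absv z = dist z 0"
  by (simp add: dist_absv)

lemma absv_nonneg: "0 \<le> absv z"
  by (simp add: absv_eq_dist)

lemma absv_add_le: "absv (a + b) \<le> absv a + absv b"
  using absv_add_le_max[of a b] absv_nonneg[of a] absv_nonneg[of b] by linarith

lemma absv_0: "absv 0 = 0"
  by (simp add: absv_eq_dist)

lemma absv_1: "absv 1 = 1"
proof -
  have "absv 1 * absv 1 = absv 1"
    using absv_mult[of 1 1] by simp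
  moreover have "absv 1 \<noteq> 0"
    by (simp add: absv_eq_dist)
  ultimately show ?thesis by simp
qed

text \<open>The symmetry of \<open>dist\<close> is what permits the change of sign.\<close>

lemma absv_minus: "absv (- z) = absv z"
  using dist_absv[of 0 z] by (simp add: absv_eq_dist dist_commute)

lemma absv_diff_le_max: "absv (a - b) \<le> max (absv a) (absv b)"
  using absv_add_le_max[of a "- b"] by (simp add: absv_minus)

lemma absv_of_nat_le_1: "absv (of_nat k) \<le> 1"
proof (induction k)
  case (Suc k)
  then show ?case
    using absv_add_le_max[of 1 "of_nat k"] by (simp add: absv_1)
qed (simp add: absv_0)

lemma absv_power: "absv (z ^ k) = absv z ^ k"
  by (induction k) (simp_all add: absv_1 absv_mult)

text \<open>
  The type class of the field does not link its arithmetic to its topology, so the continuity of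
  the operations has to come from the absolute value.
\<close>

lemma tendsto_iff_absv:
  fixes f :: "'b \<Rightarrow> 'a"
  shows "(f \<longlongrightarrow> a) F \<longleftrightarrow> ((\<lambda>z. absv (f z - a)) \<longlongrightarrow> 0) F"
  by (subst tendsto_dist_iff) (simp add: dist_absv)

lemma tendsto_add_field:
  fixes f g :: "'b \<Rightarrow> 'a"
  assumes "(f \<longlongrightarrow> a) F" and "(g \<longlongrightarrow> b) F"
  shows "((\<lambda>z. f z + g z) \<longlongrightarrow> a + b) F"
  unfolding tendsto_iff_absv
proof (rule tendsto_sandwich[OF _ _ tendsto_const])
  show "((\<lambda>z. absv (f z - a) + absv (g z - b)) \<longlongrightarrow> 0) F"
    using assms tendsto_add_zero unfolding tendsto_iff_absv by blast
  show "\<forall>\<^sub>F z in F. absv (f z + g z - (a + b)) \<le> absv (f z - a) + absv (g z - b)"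
    using absv_add_le[of "f z - a" "g z - b" for z] by (simp add: algebra_simps)
qed (simp add: absv_nonneg)

lemma tendsto_mult_field:
  fixes f g :: "'b \<Rightarrow> 'a"
  assumes "(f \<longlongrightarrow> a) F" and "(g \<longlongrightarrow> b) F"
  shows "((\<lambda>z. f z * g z) \<longlongrightarrow> a * b) F"
  unfolding tendsto_iff_absv
proof (rule tendsto_sandwich[OF _ _ tendsto_const])
  let ?u = "\<lambda>z. absv (f z - a)" and ?v = "\<lambda>z. absv (g z - b)"
  have "(?u \<longlongrightarrow> 0) F" and "(?v \<longlongrightarrow> 0) F"
    using assms unfolding tendsto_iff_absv by blast+
  then have "((\<lambda>z. ?u z * ?v z + absv a * ?v z + ?u z * absv b) \<longlongrightarrow> 0 * 0 + absv a * 0 + 0 * absv b) F"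
    by (intro tendsto_intros)
  then show "((\<lambda>z. ?u z * ?v z + absv a * ?v z + ?u z * absv b) \<longlongrightarrow> 0) F"
    by simp
  have "absv (f z * g z - a * b) \<le> ?u z * ?v z + absv a * ?v z + ?u z * absv b" for z
  proof -
    have "f z * g z - a * b = (f z - a) * (g z - b) + a * (g z - b) + (f z - a) * b"
      by (simp add: algebra_simps)
    then show ?thesis
      using absv_add_le[of "(f z - a) * (g z - b) + a * (g z - b)" "(f z - a) * b"]
        absv_add_le[of "(f z - a) * (g z - b)" "a * (g z - b)"]
      by (simp add: absv_mult)
  qed
  then show "\<forall>\<^sub>F z in F. absv (f z * g z - a * b) \<le> ?u z * ?v z + absv a * ?v z + ?u z * absv b"
    by simp
qed (simp add: absv_nonneg)

lemma tendsto_sum_field: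
  fixes f :: "'c \<Rightarrow> 'b \<Rightarrow> 'a"
  assumes "\<And>i. i \<in> A \<Longrightarrow> (f i \<longlongrightarrow> a i) F"
  shows "((\<lambda>z. \<Sum>i\<in>A. f i z) \<longlongrightarrow> (\<Sum>i\<in>A. a i)) F"
  using assms by (induction A rule: infinite_finite_induct) (simp_all add: tendsto_add_field)

text \<open>Each coefficient of a product is a finite sum of products, so coefficientwise
  convergence suffices.\<close>

lemma tendsto_fps_mult_nth:
  fixes G :: "'b \<Rightarrow> 'a fps"
  assumes "\<And>k. ((\<lambda>z. fps_nth (G z) k) \<longlongrightarrow> fps_nth G' k) F"
  shows "((\<lambda>z. fps_nth (H * G z) l) \<longlongrightarrow> fps_nth (H * G') l) F"
  unfolding fps_mult_nth by (intro tendsto_sum_field tendsto_mult_field tendsto_const assms)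

section \<open>Degenerate falling factorials: continuity, p-adic size and integrals\<close>

lemma continuous_on_degenerate_ffact:
  fixes S :: "'a set"
  shows "continuous_on S (\<lambda>y. degenerate_ffact lam (x + y) l)"
  unfolding continuous_on_def
proof
  fix a
  show "((\<lambda>y. degenerate_ffact lam (x + y) l) \<longlongrightarrow> degenerate_ffact lam (x + a) l) (at a within S)"
  proof (induction l)
    case (Suc l)
    have "((\<lambda>y. (x - of_nat l * lam) + y) \<longlongrightarrow> (x - of_nat l * lam) + a) (at a within S)"
      by (intro tendsto_add_field tendsto_const tendsto_ident_at)
    from tendsto_mult_field[OF Suc this] show ?case
      by (simp add: degenerate_ffact_Suc algebra_simps)
  qed simp
qed

text \<open>For \<open>k > 0\<close> the first factor is \<open>z\<close> itself, and by the
  ultrametric inequality every other factor has absolute value at most 1.\<close>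

lemma absv_degenerate_ffact_le:
  assumes "absv lam \<le> 1" and "absv z \<le> 1" and "k > 0"
  shows "absv (degenerate_ffact lam z k) \<le> absv z"
  using \<open>k > 0\<close>
proof (induction k rule: nat_induct_non_zero)
  case 1
  then show ?case by (simp add: degenerate_ffact_def)
next
  case (Suc k)
  have "absv (of_nat k * lam) \<le> 1"
    by (simp add: absv_mult absv_of_nat_le_1 absv_nonneg assms mult_le_one)
  then have "absv (z - of_nat k * lam) \<le> 1"
    using absv_diff_le_max[of z "of_nat k * lam"] assms(2) by linarith
  with Suc.IH show ?case
    by (simp add: degenerate_ffact_Suc absv_mult mult_left_le absv_nonneg order_trans
        mult_le_cancel_left1 mult_mono[of _ "absv z" _ 1, simplified])
qed

lemma degenerate_exp_p_power_tendsto: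
  assumes "p > 1" and "absv lam \<le> 1"
  shows "(\<lambda>N. fps_nth (degenerate_exp lam (of_nat (p ^ N))) k) \<longlonglongrightarrow> fps_nth 1 k"
proof (cases "k = 0")
  case False
  have "(\<lambda>N. degenerate_ffact lam (of_nat (p ^ N)) k) \<longlonglongrightarrow> 0"
    unfolding tendsto_iff_absv
  proof (rule tendsto_sandwich[OF _ _ tendsto_const])
    show "(\<lambda>N. (1 / real p) ^ N) \<longlonglongrightarrow> 0"
      using assms(1) by (intro LIMSEQ_power_zero) simp
    have "absv (degenerate_ffact lam (of_nat (p ^ N)) k) \<le> (1 / real p) ^ N" for N
    proof -
      have "absv (degenerate_ffact lam (of_nat (p ^ N)) k) \<le> absv (of_nat (p ^ N))"
        using absv_of_nat_le_1 assms(2) False by (blast intro: absv_degenerate_ffact_le)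
      then show ?thesis
        by (simp add: absv_power absv_p)
    qed
    then show "\<forall>\<^sub>F N in sequentially.
        absv (degenerate_ffact lam (of_nat (p ^ N)) k - 0) \<le> (1 / real p) ^ N"
      by simp
  qed (simp add: absv_nonneg)
  \<comment> \<open>The index \<open>k\<close> is fixed, so the possibly large
    \<open>1 / fact k\<close> is a constant factor and does not disturb the limit.\<close>
  from tendsto_mult_field[OF this tendsto_const[of "1 / fact k"]] show ?thesis
    using False by (simp add: degenerate_exp_nth)
qed (simp add: degenerate_exp_nth)

lemma has_fermionic_integral_degenerate_ffact:
  assumes "p > 1" and "odd p" and "lam \<noteq> 0" and "absv lam \<le> 1"
  shows "has_fermionic_integral p (\<lambda>y. degenerate_ffact lam (x + y) l)
    (fact l * fps_nth (2 * (degenerate_exp lam x * inverse (1 + degenerate_exp lam 1))) l)"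
proof -
  let ?H = "degenerate_exp lam x * inverse (1 + degenerate_exp lam 1)"
  \<comment> \<open>The limit \<open>1 + 1\<close> of the last factor is the source of the 2 in the
    generating function.\<close>
  have "(\<lambda>N. fact l * fps_nth (?H * (1 + degenerate_exp lam (of_nat (p ^ N)))) l)
      \<longlonglongrightarrow> fact l * fps_nth (?H * (1 + 1)) l"
    by (intro tendsto_mult_field tendsto_const tendsto_fps_mult_nth)
      (simp only: fps_add_nth, intro tendsto_add_field tendsto_const
        degenerate_exp_p_power_tendsto assms)
  then show ?thesis
    \<comment> \<open>As \<open>p\<close> is odd, so is \<open>p ^ N\<close>, and the closed form
      applies to every partial sum of the integral.\<close>
    using assms sum_alternating_degenerate_ffact[of lam "p ^ N" x l for N]
    by (simp add: has_fermionic_integral_def continuous_on_degenerate_ffact mult.commute[of 2])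
qed

end

text \<open>Uniqueness of limits in a metric space justifies the definite description.\<close>

lemma fermionic_integral_eqI:
  assumes "has_fermionic_integral p f I"
  shows "fermionic_integral p f = I"
  unfolding fermionic_integral_def
  using assms by (intro the_equality) (auto simp: has_fermionic_integral_def intro: LIMSEQ_unique)

theorem theorem2p1:
  fixes p n :: nat
    and absv :: "'a::{field_char_0,complete_space} \<Rightarrow> real"
    and lam x :: 'a
  assumes "prime p" and "odd p"
    and "padic_complex_numbers p absv"
    and "lam \<noteq> 0" and "absv lam \<le> 1"
  shows "(\<Sum>l\<le>n. of_int (stirling1 n l) *
            fermionic_integral p (\<lambda>y. degenerate_ffact lam (x + y) l))
         = changhee2 n lam x"
proof -
  interpret padic_complex_numbers p absv by fact
  have "p > 1" using assms(1) by (rule prime_gt_1_nat)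
  note has_fermionic_integral_degenerate_ffact[OF this assms(2,4,5)]
  note fermionic_integral_eqI[OF this]
  \<comment> \<open>Both sides are now the Stirling transform of the coefficients of
    \<open>2 * E x / (1 + E 1)\<close>, scaled by factorials.\<close>
  then show ?thesis
    by (simp only: changhee2_def changhee2_genfun_eq_compose fps_compose_ln_nth)
qed

end
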